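(* Let $\lambda,x,y$ be indeterminates, and let $\{Q_n\}_{n\ge 0}$ be the sequence of polynomials in $\lambda,x,y$ defined by $Q_0=1$ and, for $n\ge 1$, $$Q_n=\binom{\lambda}{n}(-1)^n-x\sum_{k=1}^n(-1)^k\binom{y}{k}Q_{n-k}.$$ Then for every integer $n\ge 0$, $$Q_n=\sum_{m=0}^n\sum_{i=m}^n\sum_{j=m}^i(-1)^{m-i}\,\frac{m!}{n!}\begin{bmatrix}n\\ i\end{bmatrix}\binom{i}{j}\begin{Bmatrix}j\\ m\end{Bmatrix}x^m\lambda^{i-j}y^j.$$
   Context: For an indeterminate $u$ the falling factorial is $\langle u\rangle_0=1$ and $\langle u\rangle_n=u(u-1)\cdots(u-n+1)$ for $n\ge 1$; the generalized binomial coefficient is $\binom{u}{n}=\langle u\rangle_n/n!$ for integers $n\ge 0$. The unsigned Stirling numbers of the first kind $\begin{bmatrix}n\\ k\end{bmatrix}$ are defined by $\langle u\rangle_n=\sum_{k=0}^n(-1)^{n-k}\begin{bmatrix}n\\ k\end{bmatrix}u^k$, and the Stirling numbers of the second kind $\begin{Bmatrix}n\\ k\end{Bmatrix}$ by $u^n=\sum_{k=0}^n\begin{Bmatrix}n\\ k\end{Bmatrix}\langle u\rangle_k$. *)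

theory Defs
  imports
    "HOL-Computational_Algebra.Polynomial"
    "HOL-Combinatorics.Stirling"
begin

text \<open>
  The ring of polynomials over the rationals in three indeterminates is built by adjoining
  one indeterminate at a time: \<open>\<lambda>\<close> first (innermost), then \<open>x\<close>, then \<open>y\<close> (outermost).
\<close>

type_synonym poly3 = "rat poly poly poly"

definition scalar :: "rat \<Rightarrow> poly3"
  where "scalar c = [:[:[:c:]:]:]"

definition X_lambda :: poly3
  where "X_lambda = [:[:[:0, 1:]:]:]"

definition X_x :: poly3
  where "X_x = [:[:0, 1:]:]"

definition X_y :: poly3
  where "X_y = [:0, 1:]"

definition falling_fact :: "'a::comm_ring_1 \<Rightarrow> nat \<Rightarrow> 'a"
  where "falling_fact u n = (\<Prod>i<n. u - of_nat i)"

text \<open>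
  The library's \<open>gchoose\<close> is constrained to fields of characteristic zero, so it does not
  apply to polynomials.
\<close>

definition gbinom :: "poly3 \<Rightarrow> nat \<Rightarrow> poly3"
  where "gbinom u n = scalar (1 / fact n) * falling_fact u n"

text \<open>
  The library defines the Stirling numbers by their recurrences. They are the connection
  coefficients between powers and falling factorials.
\<close>

lemma falling_fact_eq_sum_stirling:
  fixes u :: "'a::comm_ring_1"
  shows "falling_fact u n = (\<Sum>k=0..n. (-1) ^ (n - k) * of_nat (stirling n k) * u ^ k)"
proof -
  have "falling_fact u n = (-1) ^ n * pochhammer (- u) n"
  proof (induction n)
    case 0
    then show ?case by (simp add: falling_fact_def)
  next
    case (Suc n)
    then have "falling_fact u (Suc n) = (-1) ^ n * pochhammer (- u) n * (u - of_nat n)"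
      by (simp add: falling_fact_def)
    then show ?case
      by (simp add: pochhammer_Suc algebra_simps)
  qed
  also have "\<dots> = (\<Sum>k\<le>n. (-1) ^ n * (of_nat (stirling n k) * (- u) ^ k))"
    by (simp add: sum_distrib_left flip: stirling_pochhammer)
  also have "\<dots> = (\<Sum>k\<le>n. (-1) ^ (n - k) * of_nat (stirling n k) * u ^ k)"
  proof (rule sum.cong)
    fix k assume "k \<in> {..n}"
    then have "(-1 :: 'a) ^ n = (-1) ^ (n - k) * (-1) ^ k"
      by (simp flip: power_add)
    then have "(-1 :: 'a) ^ n * (-1) ^ k = (-1) ^ (n - k)"
      by (simp add: mult.assoc flip: power_mult_distrib)
    moreover have "(-1) ^ n * (of_nat (stirling n k) * (- u) ^ k) =
        ((-1) ^ n * (-1) ^ k) * of_nat (stirling n k) * u ^ k"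
      by (subst power_minus) (simp only: mult_ac)
    ultimately show "(-1) ^ n * (of_nat (stirling n k) * (- u) ^ k) =
        (-1) ^ (n - k) * of_nat (stirling n k) * u ^ k"
      by simp
  qed simp
  finally show ?thesis
    by (simp add: atMost_atLeast0)
qed

lemma power_eq_sum_Stirling:
  fixes u :: "'a::comm_ring_1"
  shows "u ^ n = (\<Sum>k=0..n. of_nat (Stirling n k) * falling_fact u k)"
proof (induction n)
  case 0
  then show ?case by (simp add: falling_fact_def)
next
  case (Suc n)
  have step: "u * falling_fact u k = falling_fact u (Suc k) + of_nat k * falling_fact u k" for k
    by (simp add: falling_fact_def algebra_simps)
  have "u ^ Suc n = (\<Sum>k\<le>n. of_nat (Stirling n k) * (u * falling_fact u k))"
    by (simp add: Suc sum_distrib_left atMost_atLeast0 mult_ac)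
  also have "\<dots> = (\<Sum>k\<le>n. of_nat (Stirling n k) * falling_fact u (Suc k))
      + (\<Sum>k\<le>n. of_nat (k * Stirling n k) * falling_fact u k)"
    by (simp add: step algebra_simps sum.distrib)
  also have "(\<Sum>k\<le>n. of_nat (k * Stirling n k) * falling_fact u k)
      = (\<Sum>k\<le>Suc n. of_nat (k * Stirling n k) * falling_fact u k)"
    by simp
  also have "\<dots> = (\<Sum>k\<le>n. of_nat (Suc k * Stirling n (Suc k)) * falling_fact u (Suc k))"
    by (subst sum.atMost_Suc_shift) simp
  also have "(\<Sum>k\<le>n. of_nat (Stirling n k) * falling_fact u (Suc k)) + \<dots>
      = (\<Sum>k\<le>n. of_nat (Stirling (Suc n) (Suc k)) * falling_fact u (Suc k))"
    by (simp add: algebra_simps sum.distrib)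
  also have "\<dots> = (\<Sum>k\<le>Suc n. of_nat (Stirling (Suc n) k) * falling_fact u k)"
    by (subst sum.atMost_Suc_shift) simp
  finally show ?case
    by (simp only: atMost_atLeast0)
qed

end

theory Submission
  imports Defs "HOL-Computational_Algebra.Formal_Power_Series"
begin

text \<open>
  Write \<open>(1 - t)\<^sup>u\<close> for the formal power series in \<open>t\<close> with coefficients
  \<open>(-1)\<^sup>n (u choose n)\<close>. The recurrence for \<open>Q\<close> says that the generating function
  \<open>\<Sum>n. Q n t\<^sup>n\<close> solves \<open>G = (1 - t)\<^sup>\<lambda> + x h G\<close> with \<open>h = 1 - (1 - t)\<^sup>y\<close>. Substituting this
  equation into itself \<open>n\<close> times gives \<open>(1 - t)\<^sup>\<lambda> (\<Sum>m\<le>n. (x h)\<^sup>m)\<close> and a remainder divisible by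
  \<open>h\<^bsup>n + 1\<^esup>\<close>; as \<open>h\<close> has no constant term, the remainder does not reach the coefficient of
  \<open>t\<^sup>n\<close>.

  By Vandermonde's identity \<open>u \<mapsto> (1 - t)\<^sup>u\<close> turns sums into products, so the binomial theorem
  turns \<open>(1 - t)\<^sup>\<lambda> h\<^sup>m\<close> into the alternating sum of \<open>(m choose k) (1 - t)\<^bsup>\<lambda> + k y\<^esup>\<close> over \<open>k\<close>.
  Up to factorials and signs the coefficients of these powers are falling factorials of
  \<open>\<lambda> + k y\<close>. Stirling numbers of the first kind
  expand these in powers \<open>(\<lambda> + k y)\<^sup>i\<close>, hence in monomials \<open>\<lambda>\<^bsup>i - j\<^esup> y\<^sup>j k\<^sup>j\<close>, and the remaining
  alternating sum of \<open>(m choose k) k\<^sup>j\<close> is \<open>(-1)\<^sup>m m!\<close> times a Stirling number of the second kind.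
\<close>

unbundle fps_syntax

section \<open>Formal powers of \<open>1 - t\<close>\<close>

lemma scalar_mult: "scalar (a * b) = scalar a * scalar b"
  by (simp add: scalar_def)

lemma scalar_one [simp]: "scalar 1 = 1"
  by (simp add: scalar_def one_pCons)

lemma scalar_of_nat [simp]: "scalar (of_nat n) = of_nat n"
  by (simp add: scalar_def of_nat_poly)

lemma scalar_neg_one_power [simp]: "scalar ((-1) ^ n) = (-1) ^ n"
proof (induction n)
  case (Suc n)
  have "scalar (-1) = -1"
    by (simp add: scalar_def one_pCons)
  with Suc show ?case
    by (simp only: power_Suc scalar_mult)
qed simp

lemma falling_fact_eq_pochhammer: "falling_fact u n = (-1) ^ n * pochhammer (- u) n"
proof (induction n)
  case 0
  then show ?case by (simp add: falling_fact_def)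
next
  case (Suc n)
  then have "falling_fact u (Suc n) = (-1) ^ n * pochhammer (- u) n * (u - of_nat n)"
    by (simp add: falling_fact_def)
  then show ?case
    by (simp add: pochhammer_Suc algebra_simps)
qed

text \<open>
  The series \<open>(1 - t)\<^sup>u\<close>. The signs \<open>(-1)\<^sup>n\<close> of its coefficients cancel those between the falling
  factorials of \<open>u\<close> and the rising factorials of \<open>- u\<close>.
\<close>

definition one_minus_powr :: "poly3 \<Rightarrow> poly3 fps"
  where "one_minus_powr u = Abs_fps (\<lambda>n. scalar (1 / fact n) * pochhammer (- u) n)"

lemma one_minus_powr_nth: "one_minus_powr u $ n = (-1) ^ n * gbinom u n"
proof -
  have "(-1) ^ n * ((-1) ^ n * p) = p" for p :: poly3
    by (simp add: mult.assoc[symmetric] flip: power_mult_distrib)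
  then show ?thesis
    by (simp add: one_minus_powr_def gbinom_def falling_fact_eq_pochhammer mult.left_commute)
qed

lemma one_minus_powr_0 [simp]: "one_minus_powr 0 = 1"
  by (rule fps_ext) (simp add: one_minus_powr_def pochhammer_0_left)

text \<open>The exponential law for \<open>(1 - t)\<^sup>u\<close> is Vandermonde's identity for rising factorials.\<close>

lemma one_minus_powr_add: "one_minus_powr (u + v) = one_minus_powr u * one_minus_powr v"
proof (rule fps_ext)
  fix n
  have coeff: "scalar (1 / fact n) * of_nat (n choose k)
      = scalar (1 / fact k) * scalar (1 / fact (n - k))" if "k \<le> n" for k
  proof -
    have "1 / fact n * of_nat (n choose k) = (1 / fact k * (1 / fact (n - k)) :: rat)"
      using that by (simp add: binomial_fact)
    then have "scalar (1 / fact n * of_nat (n choose k)) = scalar (1 / fact k * (1 / fact (n - k)))"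
      by (rule arg_cong)
    then show ?thesis
      by (simp only: scalar_mult scalar_of_nat)
  qed
  have "one_minus_powr (u + v) $ n = scalar (1 / fact n) * pochhammer (- u + - v) n"
    by (simp add: one_minus_powr_def)
  also have "\<dots> = (\<Sum>k\<le>n. (scalar (1 / fact n) * of_nat (n choose k))
      * pochhammer (- u) k * pochhammer (- v) (n - k))"
    by (simp only: pochhammer_binomial_sum sum_distrib_left mult.assoc)
  also have "\<dots> = (\<Sum>k\<le>n. one_minus_powr u $ k * one_minus_powr v $ (n - k))"
  proof (rule sum.cong)
    fix k assume "k \<in> {..n}"
    then have "k \<le> n" by simp
    show "scalar (1 / fact n) * of_nat (n choose k) * pochhammer (- u) k * pochhammer (- v) (n - k)
        = one_minus_powr u $ k * one_minus_powr v $ (n - k)"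
      unfolding coeff[OF \<open>k \<le> n\<close>] one_minus_powr_def fps_nth_Abs_fps by (simp only: mult_ac)
  qed (rule refl)
  also have "\<dots> = (one_minus_powr u * one_minus_powr v) $ n"
    by (simp add: fps_mult_nth atMost_atLeast0)
  finally show "one_minus_powr (u + v) $ n = (one_minus_powr u * one_minus_powr v) $ n" .
qed

lemma one_minus_powr_of_nat_mult: "one_minus_powr (of_nat k * u) = one_minus_powr u ^ k"
  by (induction k) (simp_all add: algebra_simps one_minus_powr_add)

section \<open>Stirling numbers in the coefficients\<close>

text \<open>
  Up to the sign \<open>(-1)\<^sup>m\<close>, the sum is the \<open>m\<close>-th forward difference of \<open>k\<^sup>j\<close> at \<open>k = 0\<close>. The
  absorption identity \<open>k (m choose k) = m ((m choose k) - (m - 1 choose k))\<close> gives it a recurrence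
  in \<open>j\<close>, which the factor \<open>(-1)\<^sup>m m!\<close> converts into the one that defines the Stirling numbers of
  the second kind.
\<close>

lemma alternating_binomial_power_sum:
  "(\<Sum>k\<le>m. (-1) ^ k * of_nat (m choose k) * of_nat k ^ j)
    = (-1) ^ m * of_nat (fact m) * (of_nat (Stirling j m) :: 'a::comm_ring_1)"
proof (induction j arbitrary: m)
  case 0
  have "(\<Sum>k\<le>m. (-1) ^ k * of_nat (m choose k)) = ((-1 + 1) ^ m :: 'a)"
    by (subst binomial_ring) (simp add: mult.commute)
  then show ?case
    by (cases m) simp_all
next
  case (Suc j)
  show ?case
  proof (cases m)
    case 0
    then show ?thesis by simp
  next
    case m: (Suc l)
    have absorb: "of_nat k * of_nat (m choose k)
        = of_nat m * (of_nat (m choose k) - of_nat (l choose k) :: 'a)" for k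
    proof (cases k)
      case (Suc i)
      have "k * (m choose k) = m * (l choose i)"
        unfolding m Suc by (rule Suc_times_binomial)
      then have "of_nat k * of_nat (m choose k) = (of_nat m * of_nat (l choose i) :: 'a)"
        by (simp only: flip: of_nat_mult)
      moreover have "(of_nat (m choose k) - of_nat (l choose k) :: 'a) = of_nat (l choose i)"
        by (simp add: m Suc)
      ultimately show ?thesis by simp
    qed simp
    have "(\<Sum>k\<le>m. (-1) ^ k * of_nat (m choose k) * of_nat k ^ Suc j)
        = (\<Sum>k\<le>m. (-1) ^ k * of_nat k ^ j * (of_nat k * of_nat (m choose k)) :: 'a)"
      by (simp add: mult_ac)
    also have "\<dots> = of_nat m * ((\<Sum>k\<le>m. (-1) ^ k * of_nat (m choose k) * of_nat k ^ j)
        - (\<Sum>k\<le>m. (-1) ^ k * of_nat (l choose k) * of_nat k ^ j))"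
      unfolding absorb by (simp add: sum_distrib_left sum_subtractf[symmetric] algebra_simps)
    also have "(\<Sum>k\<le>m. (-1) ^ k * of_nat (l choose k) * of_nat k ^ j)
        = (\<Sum>k\<le>l. (-1) ^ k * of_nat (l choose k) * of_nat k ^ j :: 'a)"
      by (simp add: m binomial_eq_0)
    finally show ?thesis
      unfolding Suc.IH by (simp add: m algebra_simps)
  qed
qed

lemma coeff_one_minus_powr_mult_power:
  "(one_minus_powr u * (1 - one_minus_powr v) ^ m) $ n
    = (\<Sum>k\<le>m. (-1) ^ k * of_nat (m choose k) * ((-1) ^ n * gbinom (u + of_nat k * v) n))"
proof -
  have "(1 - one_minus_powr v) ^ m = (- one_minus_powr v + 1) ^ m"
    by simp
  also have "\<dots> = (\<Sum>k\<le>m. of_nat (m choose k) * (- one_minus_powr v) ^ k)"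
    by (subst binomial_ring) simp
  also have "\<dots> = (\<Sum>k\<le>m. fps_const ((-1) ^ k * of_nat (m choose k)) * one_minus_powr (of_nat k * v))"
    unfolding one_minus_powr_of_nat_mult
    by (intro sum.cong refl, subst power_minus)
      (simp add: mult_ac fps_of_nat flip: fps_const_mult fps_const_power fps_const_neg)
  finally have "one_minus_powr u * (1 - one_minus_powr v) ^ m
      = (\<Sum>k\<le>m. fps_const ((-1) ^ k * of_nat (m choose k)) * one_minus_powr (u + of_nat k * v))"
    by (simp add: sum_distrib_left one_minus_powr_add mult.left_commute)
  then show ?thesis
    by (simp add: fps_sum_nth one_minus_powr_nth)
qed

text \<open>
  Only the factor \<open>(-1)\<^sup>k (m choose k) k\<^sup>j\<close> of the expanded coefficient involves \<open>k\<close>, so summing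
  over \<open>k\<close> innermost reduces the claim to the alternating sum that yields
  Stirling numbers of the second kind.
\<close>

lemma coeff_one_minus_powr_mult_power_Stirling:
  "(one_minus_powr u * (1 - one_minus_powr v) ^ m) $ n
    = (\<Sum>i=m..n. \<Sum>j=m..i.
        scalar ((-1) powi (int m - int i) * (fact m / fact n)
          * of_nat (stirling n i) * of_nat (i choose j) * of_nat (Stirling j m))
        * u ^ (i - j) * v ^ j)"
proof -
  let ?s = "\<lambda>i j. scalar ((-1) powi (int m - int i) * (fact m / fact n)
          * of_nat (stirling n i) * of_nat (i choose j) * of_nat (Stirling j m))
        * u ^ (i - j) * v ^ j"
  have scal: "?s i j = scalar (1 / fact n) * ((-1) ^ i * of_nat (stirling n i)
      * (of_nat (i choose j) * u ^ (i - j) * v ^ j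
        * ((-1) ^ m * of_nat (fact m) * of_nat (Stirling j m))))" for i j
  proof -
    have "((-1) powi (int m - int i) :: rat) = (-1) ^ m * (-1) ^ i"
      by (simp add: power_int_diff field_simps flip: power_mult_distrib)
    then have "(-1) powi (int m - int i) * (fact m / fact n)
          * of_nat (stirling n i) * of_nat (i choose j) * of_nat (Stirling j m)
        = (1 / fact n) * ((-1) ^ m * ((-1) ^ i * (of_nat (fact m)
          * (of_nat (stirling n i) * (of_nat (i choose j) * of_nat (Stirling j m))))) :: rat)"
      by (simp add: of_nat_fact)
    then have "?s i j = scalar (1 / fact n) * ((-1) ^ m * ((-1) ^ i * (of_nat (fact m)
          * (of_nat (stirling n i) * (of_nat (i choose j) * of_nat (Stirling j m))))))
        * u ^ (i - j) * v ^ j"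
      by (simp only: scalar_mult scalar_of_nat scalar_neg_one_power)
    then show ?thesis
      by (simp only: mult_ac)
  qed
  have gb: "(-1) ^ n * gbinom w n = scalar (1 / fact n)
      * (\<Sum>i\<le>n. (-1) ^ i * of_nat (stirling n i) * w ^ i)" for w
  proof -
    have "(-1) ^ n * gbinom w n = scalar (1 / fact n) * pochhammer (- w) n"
      by (simp add: one_minus_powr_def flip: one_minus_powr_nth)
    also have "pochhammer (- w) n = (\<Sum>i\<le>n. of_nat (stirling n i) * (- w) ^ i)"
      by (simp flip: stirling_pochhammer)
    also have "\<dots> = (\<Sum>i\<le>n. (-1) ^ i * of_nat (stirling n i) * w ^ i)"
      by (intro sum.cong refl, subst power_minus) (simp only: mult_ac)
    finally show ?thesis .
  qed
  have pw: "(u + of_nat k * v) ^ i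
      = (\<Sum>j\<le>i. of_nat (i choose j) * u ^ (i - j) * v ^ j * of_nat k ^ j)" for k i
    by (subst add.commute, subst binomial_ring) (simp add: power_mult_distrib mult_ac)
  have "(one_minus_powr u * (1 - one_minus_powr v) ^ m) $ n
      = (\<Sum>k\<le>m. \<Sum>i\<le>n. \<Sum>j\<le>i. scalar (1 / fact n) * ((-1) ^ i * of_nat (stirling n i)
          * (of_nat (i choose j) * u ^ (i - j) * v ^ j
            * ((-1) ^ k * of_nat (m choose k) * of_nat k ^ j))))"
    unfolding coeff_one_minus_powr_mult_power gb pw sum_distrib_left
    by (intro sum.cong refl) (simp only: mult_ac)
  also have "\<dots> = (\<Sum>i\<le>n. \<Sum>j\<le>i. \<Sum>k\<le>m. scalar (1 / fact n) * ((-1) ^ i * of_nat (stirling n i)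
          * (of_nat (i choose j) * u ^ (i - j) * v ^ j
            * ((-1) ^ k * of_nat (m choose k) * of_nat k ^ j))))"
    by (subst sum.swap, subst sum.swap[of _ _ "{..m}"]) (rule refl)
  also have "\<dots> = (\<Sum>i\<le>n. \<Sum>j\<le>i. ?s i j)"
    by (simp only: scal sum_distrib_left[symmetric] alternating_binomial_power_sum)
  \<comment> \<open>\<open>Stirling j m\<close> vanishes for \<open>j < m\<close>, which in turn leaves no \<open>j\<close> for \<open>i < m\<close>.\<close>
  also have "\<dots> = (\<Sum>i\<le>n. \<Sum>j=m..i. ?s i j)"
    by (intro sum.cong refl sum.mono_neutral_right) (auto simp: scalar_def)
  also have "\<dots> = (\<Sum>i=m..n. \<Sum>j=m..i. ?s i j)"
    by (intro sum.mono_neutral_right) auto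
  finally show ?thesis .
qed

section \<open>Solving the recurrence\<close>

text \<open>
  Multiplication by a series \<open>h\<close> without constant term raises the order in \<open>t\<close>, so finitely many substitutions of
  the equation into itself determine each coefficient of its solution.
\<close>

lemma fps_nth_affine_fixpoint:
  fixes G a h :: "'a::comm_ring_1 fps"
  assumes fixpoint: "G = a + fps_const c * h * G" and h0: "h $ 0 = 0"
  shows "G $ n = (\<Sum>m\<le>n. c ^ m * (a * h ^ m) $ n)"
proof -
  have unfolded: "G = (\<Sum>m<N. fps_const (c ^ m) * (a * h ^ m)) + fps_const (c ^ N) * (h ^ N * G)" for N
  proof (induction N)
    case (Suc N)
    have "fps_const (c ^ N) * (h ^ N * G)
        = fps_const (c ^ N) * (h ^ N * (a + fps_const c * h * G))"
      using fixpoint by simp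
    also have "\<dots> = fps_const (c ^ N) * (a * h ^ N) + fps_const (c ^ Suc N) * (h ^ Suc N * G)"
      by (simp add: algebra_simps flip: fps_const_mult)
    finally show ?case
      using Suc by (simp add: add.assoc)
  qed simp
  have "(h ^ Suc n * G) $ n = 0"
    unfolding fps_mult_nth
    by (intro sum.neutral ballI) (simp add: startsby_zero_power_prefix[OF h0] del: power_Suc)
  then show ?thesis
    by (subst unfolded[of "Suc n"]) (simp add: fps_sum_nth lessThan_Suc_atMost del: power_Suc)
qed

theorem proposition4:
  fixes Q :: "nat \<Rightarrow> poly3"
  assumes "Q 0 = 1"
    and "\<And>n. n \<ge> 1 \<Longrightarrow>
      Q n = gbinom X_lambda n * (-1) ^ n
        - X_x * (\<Sum>k=1..n. (-1) ^ k * gbinom X_y k * Q (n - k))"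
  shows "\<forall>n. Q n =
    (\<Sum>m=0..n. \<Sum>i=m..n. \<Sum>j=m..i.
      scalar ((-1) powi (int m - int i) * (fact m / fact n)
        * of_nat (stirling n i) * of_nat (i choose j) * of_nat (Stirling j m))
      * X_x ^ m * X_lambda ^ (i - j) * X_y ^ j)"
proof
  fix n
  let ?a = "one_minus_powr X_lambda" and ?h = "1 - one_minus_powr X_y"
  have h0: "?h $ 0 = 0"
    by (simp add: one_minus_powr_def)
  have fixpoint: "Abs_fps Q = ?a + fps_const X_x * ?h * Abs_fps Q"
  proof (rule fps_ext)
    fix l
    have "(?h * Abs_fps Q) $ l = (\<Sum>k=0..l. ?h $ k * Q (l - k))"
      by (simp add: fps_mult_nth)
    also have "\<dots> = (\<Sum>k=1..l. ?h $ k * Q (l - k))"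
      using h0 by (intro sum.mono_neutral_right) (auto simp: not_le)
    also have "\<dots> = (\<Sum>k=1..l. - ((-1) ^ k * gbinom X_y k * Q (l - k)))"
      by (intro sum.cong) (auto simp: one_minus_powr_nth)
    finally have conv: "(?h * Abs_fps Q) $ l
        = - (\<Sum>k=1..l. (-1) ^ k * gbinom X_y k * Q (l - k))"
      by (simp add: sum_negf)
    show "Abs_fps Q $ l = (?a + fps_const X_x * ?h * Abs_fps Q) $ l"
    proof (cases "l = 0")
      case True
      then show ?thesis
        using h0 by (simp add: assms(1) one_minus_powr_def)
    next
      case False
      then show ?thesis
        using assms(2)[of l] by (simp add: mult.assoc conv) (simp add: one_minus_powr_nth mult.commute)
    qed
  qed
  have "Q n = (\<Sum>m\<le>n. X_x ^ m * (?a * ?h ^ m) $ n)"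
    using fps_nth_affine_fixpoint[OF fixpoint h0, of n] by simp
  then show "Q n = (\<Sum>m=0..n. \<Sum>i=m..n. \<Sum>j=m..i.
      scalar ((-1) powi (int m - int i) * (fact m / fact n)
        * of_nat (stirling n i) * of_nat (i choose j) * of_nat (Stirling j m))
      * X_x ^ m * X_lambda ^ (i - j) * X_y ^ j)"
    unfolding coeff_one_minus_powr_mult_power_Stirling sum_distrib_left atMost_atLeast0
    by (simp only: mult_ac)
qed

end
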